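(* Let $\lambda$ be a nonzero real number. For every integer $n \geq 0$, \[ b_{n,\lambda}(x)=\sum_{m=0}^n \sum_{k=0}^m \binom{n}{m}\lambda^{m-k}S_1(m,k)\,b_{n-m,\lambda}\,x^k . \]
   Context: For a nonzero real $\lambda$, the degenerate ordered Bell polynomials $b_{n,\lambda}(x)$ are defined by the formal power series identity \[ \frac{1}{2-(1+\lambda t)^{1/\lambda}}(1+\lambda t)^{x/\lambda}=\sum_{n=0}^\infty b_{n,\lambda}(x)\frac{t^n}{n!}, \] where $(1+\lambda t)^{a/\lambda}=\exp\big(\tfrac{a}{\lambda}\log(1+\lambda t)\big)$. The degenerate ordered Bell numbers are $b_{n,\lambda}=b_{n,\lambda}(0)$. The (signed) Stirling numbers of the first kind $S_1(n,l)$ are defined by $x(x-1)\cdots(x-n+1)=\sum_{l=0}^n S_1(n,l)x^l$. *)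

theory Defs
  imports "HOL-Computational_Algebra.Computational_Algebra"
begin

(* The formal power series (1 + l t)^(a/l) = exp ((a/l) log (1 + l t)) in t.
   In the library, fps_ln 1 is log (1 + t), and "oo" is composition of
   formal power series.  Only meaningful for l \<noteq> 0. *)
definition degenerate_exp :: "real \<Rightarrow> real \<Rightarrow> real fps" where
  "degenerate_exp l a =
     fps_exp 1 oo (fps_const (a / l) * (fps_ln 1 oo (fps_const l * fps_X)))"

(* The denominator has constant coefficient 1, so it is a unit in real fps. *)
definition degenerate_ordered_bell_gf :: "real \<Rightarrow> real \<Rightarrow> real fps" where
  "degenerate_ordered_bell_gf l x =
     1 / (2 - degenerate_exp l 1) * degenerate_exp l x"

definition degenerate_ordered_bell_poly :: "nat \<Rightarrow> real \<Rightarrow> real \<Rightarrow> real" where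
  "degenerate_ordered_bell_poly n l x = fact n * fps_nth (degenerate_ordered_bell_gf l x) n"

definition degenerate_ordered_bell :: "nat \<Rightarrow> real \<Rightarrow> real" where
  "degenerate_ordered_bell n l = degenerate_ordered_bell_poly n l 0"

(* Signed, unlike the library's unsigned numbers "stirling": the coefficients of
   x (x - 1) ... (x - n + 1). *)
definition Stirling1 :: "nat \<Rightarrow> nat \<Rightarrow> int" where
  "Stirling1 n k = coeff (\<Prod>i<n. [:- int i, 1:]) k"

end

(* Since (1 + l t)^(x/l) is the binomial series of x/l at l t, its m-th coefficient times m! is
   x (x - l) ... (x - (m - 1) l), which expands into Stirling numbers of the first kind.
   The generating function of the polynomials is that of the numbers times this series, and
   the claim is the resulting Cauchy product. *)
theory Submission imports Defs
begin

text \<open>The binomial series is the only solution of \<open>f' = c f / (1 + X)\<close> with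
  constant term 1, and the chain rule gives this equation for the composite.\<close>

lemma fps_exp_compose_fps_ln:
  fixes c :: "'a::field_char_0"
  shows "fps_exp 1 oo (fps_const c * fps_ln 1) = fps_binomial c"
proof -
  let ?f = "fps_exp 1 oo (fps_const c * fps_ln 1)"
  have "fps_deriv ?f = fps_const c * ?f / (1 + fps_X)"
    by (simp add: fps_compose_deriv fps_ln_deriv fps_divide_unit mult_ac)
  moreover have "?f $ 0 = 1"
    by simp
  ultimately show ?thesis
    using fps_binomial_ODE_unique'[of ?f c] by blast
qed

lemma degenerate_exp_eq_binomial:
  "degenerate_exp l a = fps_binomial (a / l) oo (fps_const l * fps_X)"
proof -
  have "fps_const (a / l) * (fps_ln 1 oo (fps_const l * fps_X)) =
      (fps_const (a / l) * fps_ln 1) oo (fps_const l * fps_X)"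
    by (simp add: fps_compose_mult_distrib)
  then show ?thesis
    by (simp add: degenerate_exp_def fps_compose_assoc fps_exp_compose_fps_ln)
qed

lemma degenerate_exp_0 [simp]: "degenerate_exp l 0 = 1"
  by (simp add: degenerate_exp_eq_binomial)

lemma Stirling1_0_left: "Stirling1 0 k = (if k = 0 then 1 else 0)"
  by (simp add: Stirling1_def)

lemma Stirling1_Suc_0: "Stirling1 (Suc n) 0 = - int n * Stirling1 n 0"
  by (simp add: Stirling1_def)

lemma Stirling1_Suc_Suc: "Stirling1 (Suc n) (Suc k) = Stirling1 n k - int n * Stirling1 n (Suc k)"
  \<comment> \<open>The new linear factor is moved to the front, where multiplication by it is a
    shift plus a scaling.\<close>
  by (simp add: Stirling1_def mult.commute[of _ "[:- int n, 1:]"])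

lemma Stirling1_eq_0: "n < k \<Longrightarrow> Stirling1 n k = 0"
proof (induction n arbitrary: k)
  case 0
  then show ?case by (simp add: Stirling1_0_left)
next
  case (Suc n)
  then show ?case by (cases k) (auto simp: Stirling1_Suc_Suc)
qed

text \<open>Carries the defining expansion from integer polynomials to values in any commutative
  ring; it is applied at \<open>x / l\<close>.\<close>

lemma falling_factorial_eq_sum_Stirling1:
  fixes y :: "'a::comm_ring_1"
  shows "(\<Prod>i<n. y - of_nat i) = (\<Sum>k\<le>n. of_int (Stirling1 n k) * y ^ k)"
proof (induction n)
  case 0
  then show ?case by (simp add: Stirling1_0_left)
next
  case (Suc n)
  let ?S = "\<lambda>k. of_int (Stirling1 n k) * y ^ k"
  have "(\<Sum>k\<le>Suc n. of_int (Stirling1 (Suc n) k) * y ^ k) =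
      y * (\<Sum>k\<le>n. ?S k) - of_nat n * (?S 0 + (\<Sum>k\<le>n. ?S (Suc k)))"
    by (simp add: sum.atMost_Suc_shift Stirling1_Suc_0 Stirling1_Suc_Suc algebra_simps
        sum_subtractf sum_distrib_left del: sum.atMost_Suc)
  \<comment> \<open>The left side sums \<open>?S\<close> up to \<open>Suc n\<close>, but its top
    term vanishes.\<close>
  also have "?S 0 + (\<Sum>k\<le>n. ?S (Suc k)) = (\<Sum>k\<le>n. ?S k)"
    using sum.atMost_Suc_shift[of ?S n] by (simp add: Stirling1_eq_0)
  finally show ?case
    using Suc by (simp add: algebra_simps)
qed

lemma fact_mult_degenerate_exp_nth:
  assumes "l \<noteq> 0"
  shows "fact m * degenerate_exp l x $ m =
    (\<Sum>k\<le>m. l ^ (m - k) * real_of_int (Stirling1 m k) * x ^ k)"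
proof -
  \<comment> \<open>Substituting \<open>l t\<close> for \<open>t\<close> contributes
    \<open>l ^ m\<close>; the factorial cancels the denominator of the generalized binomial
    coefficient.\<close>
  have "fact m * degenerate_exp l x $ m = l ^ m * (\<Prod>i<m. x / l - real i)"
    by (simp add: degenerate_exp_eq_binomial gbinomial_prod_rev atLeast0LessThan)
  also have "\<dots> = (\<Sum>k\<le>m. l ^ (m - k) * real_of_int (Stirling1 m k) * x ^ k)"
    unfolding falling_factorial_eq_sum_Stirling1 sum_distrib_left
    \<comment> \<open>Each term uses \<open>l ^ m * (x / l) ^ k = l ^ (m - k) * x ^ k\<close>, valid
      as \<open>k \<le> m\<close> and \<open>l \<noteq> 0\<close>.\<close>
    using assms by (intro sum.cong) (auto simp: power_diff power_divide)
  finally show ?thesis .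
qed

theorem theorem4:
  fixes l x :: real and n :: nat
  assumes "l \<noteq> 0"
  shows "degenerate_ordered_bell_poly n l x =
    (\<Sum>m=0..n. \<Sum>k=0..m.
       real (n choose m) * l ^ (m - k) * real_of_int (Stirling1 m k)
         * degenerate_ordered_bell (n - m) l * x ^ k)"
proof -
  let ?B = "degenerate_ordered_bell_gf l 0"
  \<comment> \<open>\<open>?B\<close> is the bare reciprocal, since
    \<open>degenerate_exp l 0 = 1\<close>.\<close>
  have "degenerate_ordered_bell_gf l x = degenerate_exp l x * ?B"
    by (simp add: degenerate_ordered_bell_gf_def mult.commute)
  then have "degenerate_ordered_bell_poly n l x =
      (\<Sum>m=0..n. fact n * (degenerate_exp l x $ m * ?B $ (n - m)))"
    by (simp add: degenerate_ordered_bell_poly_def fps_mult_nth sum_distrib_left)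
  \<comment> \<open>Here \<open>n!\<close> is split as \<open>(n choose m) * m! * (n - m)!\<close>,
    one factorial for each coefficient.\<close>
  also have "\<dots> = (\<Sum>m=0..n. real (n choose m) * degenerate_ordered_bell (n - m) l *
      (fact m * degenerate_exp l x $ m))"
    by (intro sum.cong)
      (auto simp: degenerate_ordered_bell_def degenerate_ordered_bell_poly_def binomial_fact)
  also have "\<dots> = (\<Sum>m=0..n. \<Sum>k=0..m.
       real (n choose m) * l ^ (m - k) * real_of_int (Stirling1 m k)
         * degenerate_ordered_bell (n - m) l * x ^ k)"
    unfolding fact_mult_degenerate_exp_nth[OF assms] sum_distrib_left atLeast0AtMost
    by (intro sum.cong) (simp_all add: mult_ac)
  finally show ?thesis .
qed

end
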